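(* Let $X$ and $Y$ be Hausdorff locally convex topological vector spaces, $\varphi: X\times Y\to\overline{\mathbb{R}}$ a proper convex function, $g_i: X\times Y\to\mathbb{R}$, $i\in I:=\{1,\dots,m\}$, continuous convex functions, $C\subset X\times Y$ a convex set, and, for $j\in J:=\{1,\dots,k\}$, let $h_j(x,y)=\langle(x_j^*,y_j^* ),(x,y)\rangle-\alpha_j$ with $(x_j^*,y_j^* )\in X^*\times Y^*$ and $\alpha_j\in\mathbb{R}$. Let $\mu$ be the optimal value function and $M$ the solution map of the parametric problem $$\min\{\varphi(x,y)\mid (x,y)\in C,\ g_i(x,y)\le 0,\ i\in I,\ h_j(x,y)=0,\ j\in J\}$$ (minimization over $y\in Y$, with parameter $x\in X$). Suppose that $M(\bar x)$ is nonempty for some $\bar x\in{\rm dom}\,\mu$. If $\varphi$ is continuous at a point $(x^0,y^0)\in{\rm int}\,C$ with $g_i(x^0,y^0)<0$ for all $i\in I$ and $h_j(x^0,y^0)=0$ for all $j\in J$, then for any $\bar y\in M(\bar x)$ one has $$\partial\mu(\bar x)\subset\bigcup_{(\lambda,\nu)\in\Lambda(\bar x,\bar y)}\partial_x L(\bar x,\bar y,\lambda,\nu),$$ where $\partial_x L(\bar x,\bar y,\lambda,\nu)$ stands for the subdifferential of $L(\cdot,\bar y,\lambda,\nu)$ at $\bar x$.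
   Context: $\overline{\mathbb{R}}=[-\infty,+\infty]$; $X^*,Y^*$ are the topological duals, and $\langle(x^*,y^* ),(x,y)\rangle=\langle x^*,x\rangle+\langle y^*,y\rangle$. A function $f: Z\to\overline{\mathbb{R}}$ is proper if $f>-\infty$ everywhere and ${\rm dom}\,f=\{z\mid f(z)<+\infty\}\neq\emptyset$; convex if its epigraph $\{(z,\alpha)\in Z\times\mathbb{R}\mid\alpha\ge f(z)\}$ is convex. "Continuous at a point" means finite-valued and continuous there. For $f$ convex and finite at $\bar z$, $\partial f(\bar z)=\{z^*\in Z^*\mid\langle z^*,z-\bar z\rangle\le f(z)-f(\bar z)\ \forall z\in Z\}$ (for $\bar z\notin{\rm dom}\,f$, $\partial f(\bar z)=\emptyset$). Let $G(x)=\{y\in Y\mid(x,y)\in C,\ g_i(x,y)\le 0\ \forall i\in I,\ h_j(x,y)=0\ \forall j\in J\}$. Then $\mu(x)=\inf\{\varphi(x,y)\mid y\in G(x)\}$ (with $\inf\emptyset=+\infty$), ${\rm dom}\,\mu=\{x\mid\mu(x)<+\infty\}$, and $M(x)=\{y\in G(x)\mid\mu(x)=\varphi(x,y)\}$. The Lagrangian is $$L(x,y,\lambda,\nu)=\varphi(x,y)+\sum_{i\in I}\lambda_i g_i(x,y)+\sum_{j\in J}\nu_j h_j(x,y)+\iota_C((x,y)),\quad\lambda\in\mathbb{R}^m,\ \nu\in\mathbb{R}^k,$$ where $\iota_C$ is the indicator function ($0$ on $C$, $+\infty$ off $C$). The Lagrange multiplier set $\Lambda(\bar x,\bar y)$ consists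 of the pairs $(\lambda,\nu)\in\mathbb{R}^m\times\mathbb{R}^k$ such that $0\in\partial_y L(\bar x,\bar y,\lambda,\nu)$, $\lambda_i g_i(\bar x,\bar y)=0$ and $\lambda_i\ge 0$ for $i=1,\dots,m$, where $\partial_y L(\bar x,\bar y,\lambda,\nu)$ is the subdifferential of $L(\bar x,\cdot,\lambda,\nu)$ at $\bar y$. *)

theory Defs
  imports "HOL-Analysis.Analysis"
begin

text \<open>Hausdorff locally convex topological vector spaces over the reals. Inside the class
  specification joint continuity of scalar multiplication and convexity are written out; the
  lemmas \<open>continuous_on_scaleR_UNIV\<close> and \<open>locally_convex\<close> restate them in library terms.\<close>

class locally_convex_space = real_vector + t2_space + topological_ab_group_add +
  assumes tendsto_scaleR_Pair:
      "LIM p (nhds r \<times>\<^sub>F nhds a). fst p *\<^sub>R snd p :> nhds (r *\<^sub>R a)"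
    and locally_convex_unfolded:
      "open U \<Longrightarrow> 0 \<in> U \<Longrightarrow>
        \<exists>V. open V \<and> 0 \<in> V \<and> V \<subseteq> U \<and>
          (\<forall>x\<in>V. \<forall>y\<in>V. \<forall>u\<ge>0. \<forall>v\<ge>0. u + v = 1 \<longrightarrow> u *\<^sub>R x + v *\<^sub>R y \<in> V)"

lemma continuous_on_scaleR_UNIV:
  "continuous_on UNIV (\<lambda>p :: real \<times> 'a::locally_convex_space. fst p *\<^sub>R snd p)"
proof -
  have "((\<lambda>p. fst p *\<^sub>R snd p) \<longlongrightarrow> fst q *\<^sub>R snd q) (nhds q)" for q :: "real \<times> 'a"
    using tendsto_scaleR_Pair[of "fst q" "snd q"] by (simp add: nhds_prod[symmetric])
  then show ?thesis
    unfolding continuous_on_def by (blast intro: tendsto_mono at_within_le_nhds)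
qed

lemma locally_convex:
  fixes U :: "'a::locally_convex_space set"
  assumes "open U" and "0 \<in> U"
  shows "\<exists>V. open V \<and> convex V \<and> 0 \<in> V \<and> V \<subseteq> U"
  using locally_convex_unfolded[OF assms] unfolding convex_def by blast

definition dual_space :: "('a::{real_vector,topological_space} \<Rightarrow> real) set" where
  "dual_space = {f. linear f \<and> continuous_on UNIV f}"

definition effective_domain :: "('a \<Rightarrow> ereal) \<Rightarrow> 'a set" where
  "effective_domain f = {z. f z < \<infinity>}"

definition proper :: "('a \<Rightarrow> ereal) \<Rightarrow> bool" where
  "proper f \<longleftrightarrow> (\<forall>z. f z > -\<infinity>) \<and> effective_domain f \<noteq> {}"

text \<open>The library notions \<^const>\<open>epigraph\<close> and \<^const>\<open>convex_on\<close> only cover real-valued functions.\<close>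

definition ereal_epigraph :: "('a \<Rightarrow> ereal) \<Rightarrow> ('a \<times> real) set" where
  "ereal_epigraph f = {(z, \<alpha>). ereal \<alpha> \<ge> f z}"

definition ereal_convex :: "('a::real_vector \<Rightarrow> ereal) \<Rightarrow> bool" where
  "ereal_convex f \<longleftrightarrow> convex (ereal_epigraph f)"

definition continuous_at_point :: "('a::t2_space \<Rightarrow> ereal) \<Rightarrow> 'a \<Rightarrow> bool" where
  "continuous_at_point f z \<longleftrightarrow> \<bar>f z\<bar> \<noteq> \<infinity> \<and> isCont f z"

text \<open>The subdifferential is empty at points where the function is not finite; the
  difference below therefore never has the form \<open>\<infinity> - \<infinity>\<close>.\<close>

definition subdifferential ::
    "('a::{real_vector,topological_space} \<Rightarrow> ereal) \<Rightarrow> 'a \<Rightarrow> ('a \<Rightarrow> real) set" where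
  "subdifferential f zb =
     {zs \<in> dual_space. \<bar>f zb\<bar> \<noteq> \<infinity> \<and> (\<forall>z. ereal (zs (z - zb)) \<le> f z - f zb)}"

definition indicator_fun :: "'a set \<Rightarrow> 'a \<Rightarrow> ereal" where
  "indicator_fun C z = (if z \<in> C then 0 else \<infinity>)"

text \<open>The constraint functions are families indexed by \<open>{1..m}\<close> and \<open>{1..k}\<close>; the values of
  \<open>g\<close> and \<open>h\<close> at other indices are irrelevant. The cases \<open>m = 0\<close> and \<open>k = 0\<close> (no constraints of
  that kind) are included.\<close>

definition feasible ::
    "nat \<Rightarrow> nat \<Rightarrow> ('x \<times> 'y) set \<Rightarrow> (nat \<Rightarrow> 'x \<times> 'y \<Rightarrow> real) \<Rightarrow> (nat \<Rightarrow> 'x \<times> 'y \<Rightarrow> real)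
      \<Rightarrow> 'x \<Rightarrow> 'y set" where
  "feasible m k C g h x =
     {y. (x, y) \<in> C \<and> (\<forall>i\<in>{1..m}. g i (x, y) \<le> 0) \<and> (\<forall>j\<in>{1..k}. h j (x, y) = 0)}"

definition optimal_value ::
    "nat \<Rightarrow> nat \<Rightarrow> ('x \<times> 'y \<Rightarrow> ereal) \<Rightarrow> ('x \<times> 'y) set \<Rightarrow> (nat \<Rightarrow> 'x \<times> 'y \<Rightarrow> real)
      \<Rightarrow> (nat \<Rightarrow> 'x \<times> 'y \<Rightarrow> real) \<Rightarrow> 'x \<Rightarrow> ereal" where
  "optimal_value m k \<phi> C g h x = (INF y\<in>feasible m k C g h x. \<phi> (x, y))"

definition solution_map ::
    "nat \<Rightarrow> nat \<Rightarrow> ('x \<times> 'y \<Rightarrow> ereal) \<Rightarrow> ('x \<times> 'y) set \<Rightarrow> (nat \<Rightarrow> 'x \<times> 'y \<Rightarrow> real)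
      \<Rightarrow> (nat \<Rightarrow> 'x \<times> 'y \<Rightarrow> real) \<Rightarrow> 'x \<Rightarrow> 'y set" where
  "solution_map m k \<phi> C g h x =
     {y \<in> feasible m k C g h x. optimal_value m k \<phi> C g h x = \<phi> (x, y)}"

definition Lagrangian ::
    "nat \<Rightarrow> nat \<Rightarrow> ('x \<times> 'y \<Rightarrow> ereal) \<Rightarrow> ('x \<times> 'y) set \<Rightarrow> (nat \<Rightarrow> 'x \<times> 'y \<Rightarrow> real)
      \<Rightarrow> (nat \<Rightarrow> 'x \<times> 'y \<Rightarrow> real) \<Rightarrow> 'x \<Rightarrow> 'y \<Rightarrow> (nat \<Rightarrow> real) \<Rightarrow> (nat \<Rightarrow> real) \<Rightarrow> ereal" where
  "Lagrangian m k \<phi> C g h x y l \<nu> =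
     \<phi> (x, y) + ereal (\<Sum>i\<in>{1..m}. l i * g i (x, y)) + ereal (\<Sum>j\<in>{1..k}. \<nu> j * h j (x, y))
       + indicator_fun C (x, y)"

text \<open>The spaces \<open>\<real>\<^sup>m\<close> and \<open>\<real>\<^sup>k\<close> of multipliers are the extensional function spaces
  \<open>{1..m} \<rightarrow>\<^sub>E UNIV\<close> and \<open>{1..k} \<rightarrow>\<^sub>E UNIV\<close>.\<close>

definition Lagrange_multipliers ::
    "nat \<Rightarrow> nat \<Rightarrow> ('x \<times> 'y::{real_vector,topological_space} \<Rightarrow> ereal) \<Rightarrow> ('x \<times> 'y) set
      \<Rightarrow> (nat \<Rightarrow> 'x \<times> 'y \<Rightarrow> real) \<Rightarrow> (nat \<Rightarrow> 'x \<times> 'y \<Rightarrow> real) \<Rightarrow> 'x \<Rightarrow> 'y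
      \<Rightarrow> ((nat \<Rightarrow> real) \<times> (nat \<Rightarrow> real)) set" where
  "Lagrange_multipliers m k \<phi> C g h xb yb =
     {(l, \<nu>). l \<in> {1..m} \<rightarrow>\<^sub>E UNIV \<and> \<nu> \<in> {1..k} \<rightarrow>\<^sub>E UNIV \<and>
       (\<lambda>_. 0) \<in> subdifferential (\<lambda>y. Lagrangian m k \<phi> C g h xb y l \<nu>) yb \<and>
       (\<forall>i\<in>{1..m}. l i * g i (xb, yb) = 0 \<and> l i \<ge> 0)}"

end

theory Submission
  imports Defs
begin

text \<open>
  The inclusion is a Lagrange multiplier rule for one fixed convex program in the joint variable
  \<open>z = (x, y)\<close>. If \<open>xt\<close> is a subgradient of the optimal value function at \<open>xb\<close>, then
  \<open>(xb, yb)\<close> minimises \<open>\<phi> (x, y) - xt x\<close> over all feasible pairs. It suffices to find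
  multipliers \<open>l \<ge> 0\<close> and \<open>\<nu>\<close> for which the Lagrangian minus \<open>xt x\<close> is bounded below by
  \<open>\<phi> (xb, yb) - xt xb\<close> on the whole product space. Evaluating the bound at \<open>(xb, yb)\<close> forces
  complementary slackness, so that the Lagrangian equals \<open>\<phi>\<close> there. Freezing \<open>x = xb\<close> in the bound
  then says that the zero functional is a partial subgradient in \<open>y\<close>, and freezing \<open>y = yb\<close> says
  that \<open>xt\<close> is a partial subgradient in \<open>x\<close>.

  The multiplier rule (\<open>convex_multiplier_rule\<close>) lives on the convex set
  \<open>D = C \<inter> dom \<phi>\<close>, where \<open>\<phi>\<close> is real-valued. Instead of a separation theorem in the
  infinite-dimensional space, or in the space of constraint values, the constraints are removed one
  at a time. Removing one constraint \<open>h\<close> means finding a number \<open>c\<close> with \<open>f + c h \<ge> 0\<close>,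
  that is, a number between all quotients \<open>- f z / h z\<close> with \<open>h z > 0\<close> and all quotients
  \<open>f w / (- h w)\<close> with \<open>h w < 0\<close>. These two families are in the right order because the segment
  from \<open>w\<close> to \<open>z\<close> contains a point that satisfies the constraint, where \<open>f \<ge> 0\<close>
  (\<open>multiplier_of_cross_inequality\<close>).

  The Slater point provides the quotients of the second family for an inequality. For equalities one
  uses that it lies in the interior of \<open>D\<close>: every segment of \<open>D\<close> that ends there can be prolonged
  inside \<open>D\<close>, so an affine constraint that vanishes there is either zero or takes both signs on
  what remains of \<open>D\<close>. In the first case, that of a redundant equality, any multiplier fits; in
  the second both families of quotients are nonempty. Continuity of \<open>\<phi>\<close> at the Slater point,
  which lies in the interior of \<open>C\<close>, makes it an interior point of \<open>D\<close>.
\<close>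

section \<open>Removing a single constraint\<close>

text \<open>The multiplier is the infimum of the quotients \<open>f w / (- h w)\<close>. The lower bound \<open>b\<close>
  makes the infimum finite. For an inequality constraint \<open>b = 0\<close> will do, which also gives the sign
  of the multiplier; for an equality, \<open>b\<close> is one of the quotients \<open>- f z / h z\<close> with
  \<open>h z > 0\<close>.\<close>

lemma multiplier_of_cross_inequality:
  fixes f h :: "'a \<Rightarrow> real"
  assumes neg: "w0 \<in> D" "h w0 < 0"
    and cross: "\<And>w z. w \<in> D \<Longrightarrow> z \<in> D \<Longrightarrow> h w < 0 \<Longrightarrow> 0 < h z \<Longrightarrow> 0 \<le> h z * f w + (- h w) * f z"
    and zero: "\<And>z. z \<in> D \<Longrightarrow> h z = 0 \<Longrightarrow> 0 \<le> f z"
    and lower: "\<And>w. w \<in> D \<Longrightarrow> h w < 0 \<Longrightarrow> b \<le> f w / (- h w)"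
  obtains c where "b \<le> c" "\<And>z. z \<in> D \<Longrightarrow> 0 \<le> f z + c * h z"
proof -
  define Q where "Q = (\<lambda>w. f w / (- h w)) ` {w \<in> D. h w < 0}"
  have ne: "Q \<noteq> {}"
    using neg by (auto simp: Q_def)
  have bdd: "bdd_below Q"
    using lower by (intro bdd_belowI[of _ b]) (auto simp: Q_def)
  show ?thesis
  proof (rule that[of "Inf Q"])
    show "b \<le> Inf Q"
      using lower by (intro cInf_greatest[OF ne]) (auto simp: Q_def)
    fix z assume z: "z \<in> D"
    consider "h z < 0" | "h z = 0" | "0 < h z"
      by linarith
    then show "0 \<le> f z + Inf Q * h z"
    proof cases
      case 1
      then have "Inf Q \<le> f z / (- h z)"
        using z by (intro cInf_lower[OF _ bdd]) (auto simp: Q_def)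
      then have "Inf Q * (- h z) \<le> f z"
        using 1 pos_le_divide_eq[of "- h z" "Inf Q" "f z"] by linarith
      then show ?thesis
        by simp
    next
      case 2
      then show ?thesis
        using zero[OF z] by simp
    next
      case 3
      have "- f z / h z \<le> Inf Q"
      proof (rule cInf_greatest[OF ne])
        fix q assume "q \<in> Q"
        then obtain w where w: "w \<in> D" "h w < 0" "q = f w / (- h w)"
          by (auto simp: Q_def)
        have "(- f z) * (- h w) \<le> f w * h z"
          using cross[OF w(1) z w(2) 3] by (simp add: algebra_simps)
        then show "- f z / h z \<le> q"
          unfolding w(3) using w(2) 3 by (subst divide_le_eq) (simp_all add: field_simps)
      qed
      then have "- f z \<le> Inf Q * h z"
        using 3 pos_divide_le_eq[of "h z" "- f z" "Inf Q"] by linarith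
      then show ?thesis
        by linarith
    qed
  qed
qed

text \<open>With \<open>a = h z\<close> and \<open>b = - h w\<close> the point \<open>p\<close> is the one where the chord of \<open>h\<close>
  over the segment from \<open>w\<close> to \<open>z\<close> crosses zero. One point \<open>p\<close> has to serve several
  functions, hence the explicit formula.\<close>

lemma convex_on_weighted:
  fixes f :: "'a::real_vector \<Rightarrow> real"
  assumes "convex_on D f" "w \<in> D" "z \<in> D" "0 < a" "0 < b"
  defines "p \<equiv> (a / (a + b)) *\<^sub>R w + (b / (a + b)) *\<^sub>R z"
  shows "(a + b) * f p \<le> a * f w + b * f z"
proof -
  have ab: "a / (a + b) + b / (a + b) = 1"
    using assms(4,5) by (simp flip: add_divide_distrib)
  have "f p \<le> a / (a + b) * f w + b / (a + b) * f z"
    unfolding p_def using assms(1) unfolding convex_on_def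
    using assms(2-5) ab divide_nonneg_pos[of a "a + b"] divide_nonneg_pos[of b "a + b"]
    by (meson add_pos_pos less_imp_le)
  then have "f p \<le> (a * f w + b * f z) / (a + b)"
    by (simp add: add_divide_distrib)
  then show ?thesis
    using assms(4,5) by (simp add: pos_le_divide_eq mult.commute)
qed

lemma convex_weighted_mem:
  assumes "convex D" "w \<in> D" "z \<in> D" "0 < a" "0 < (b::real)"
  shows "(a / (a + b)) *\<^sub>R w + (b / (a + b)) *\<^sub>R z \<in> D"
  using assms by (intro convexD) (auto simp flip: add_divide_distrib)

lemma convex_sublevel:
  assumes "convex_on D f"
  shows "convex {z \<in> D. f z \<le> 0}"
proof (rule convexI)
  fix w z and u v :: real
  assume *: "w \<in> {z \<in> D. f z \<le> 0}" "z \<in> {z \<in> D. f z \<le> 0}" "0 \<le> u" "0 \<le> v" "u + v = 1"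
  then have "f (u *\<^sub>R w + v *\<^sub>R z) \<le> u * f w + v * f z"
    using assms unfolding convex_on_def by blast
  also have "\<dots> \<le> 0"
    using * by (intro add_nonpos_nonpos mult_nonneg_nonpos) auto
  finally show "u *\<^sub>R w + v *\<^sub>R z \<in> {z \<in> D. f z \<le> 0}"
    using * assms by (auto simp: convex_on_def convexD)
qed

lemma convex_affine_slice:
  assumes "convex D" and "\<And>j. j \<in> J \<Longrightarrow> convex_on D (h j)" "\<And>j. j \<in> J \<Longrightarrow> concave_on D (h j)"
  shows "convex {z \<in> D. \<forall>j\<in>J. h j z = 0}"
proof -
  have "{z \<in> D. \<forall>j\<in>J. h j z = 0}
      = D \<inter> (\<Inter>j\<in>J. {z \<in> D. h j z \<le> 0} \<inter> {z \<in> D. - h j z \<le> 0})"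
    by force
  moreover have "convex {z \<in> D. h j z \<le> 0}" "convex {z \<in> D. - h j z \<le> 0}" if "j \<in> J" for j
    using assms(2,3)[OF that] convex_sublevel[of D "\<lambda>z. - h j z"] convex_sublevel[of D "h j"]
    unfolding concave_on_def by blast+
  ultimately show ?thesis
    using assms(1) by (simp only:) (intro convex_Int convex_INT)
qed

lemma inequality_multiplier:
  fixes f g :: "'a::real_vector \<Rightarrow> real"
  assumes f: "convex_on D f" and g: "convex_on D g"
    and slater: "z0 \<in> D" "g z0 < 0"
    and nonneg: "\<And>z. z \<in> D \<Longrightarrow> g z \<le> 0 \<Longrightarrow> 0 \<le> f z"
  obtains c where "0 \<le> c" "\<And>z. z \<in> D \<Longrightarrow> 0 \<le> f z + c * g z"
proof (rule multiplier_of_cross_inequality[of z0 D g f 0])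
  fix w z assume wz: "w \<in> D" "z \<in> D" "g w < 0" "0 < g z"
  define p where "p = (g z / (g z + - g w)) *\<^sub>R w + (- g w / (g z + - g w)) *\<^sub>R z"
  have D: "convex D"
    using f by (simp add: convex_on_def)
  have p: "p \<in> D"
    unfolding p_def using wz D by (intro convex_weighted_mem) auto
  have "(g z + - g w) * g p \<le> g z * g w + - g w * g z"
    unfolding p_def using wz g by (intro convex_on_weighted) auto
  then have "(g z + - g w) * g p \<le> 0"
    by (simp add: mult.commute)
  then have "g p \<le> 0"
    using wz by (simp add: mult_le_0_iff)
  then have "0 \<le> (g z + - g w) * f p"
    using wz nonneg[OF p] by simp
  also have "\<dots> \<le> g z * f w + - g w * f z"
    unfolding p_def using wz f by (intro convex_on_weighted) auto
  finally show "0 \<le> g z * f w + - g w * f z" .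
next
  fix w assume "w \<in> D" "g w < 0"
  then show "0 \<le> f w / - g w"
    using nonneg[of w] by (intro divide_nonneg_nonneg) auto
qed (use slater nonneg that in auto)

lemma equality_multiplier:
  fixes f h :: "'a::real_vector \<Rightarrow> real"
  assumes f: "convex_on D f" and h: "convex_on D h" "concave_on D h"
    and signs: "(\<forall>z\<in>D. h z = 0) \<or> (\<exists>w\<in>D. \<exists>z\<in>D. h w < 0 \<and> 0 < h z)"
    and nonneg: "\<And>z. z \<in> D \<Longrightarrow> h z = 0 \<Longrightarrow> 0 \<le> f z"
  obtains c where "\<And>z. z \<in> D \<Longrightarrow> 0 \<le> f z + c * h z"
  using signs
proof
  assume "\<forall>z\<in>D. h z = 0"
  then show ?thesis
    using that[of 0] nonneg by simp
next
  assume "\<exists>w\<in>D. \<exists>z\<in>D. h w < 0 \<and> 0 < h z"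
  then obtain w0 z0 where wz0: "w0 \<in> D" "z0 \<in> D" "h w0 < 0" "0 < h z0"
    by blast
  have cross: "0 \<le> h z * f w + - h w * f z"
    if wz: "w \<in> D" "z \<in> D" "h w < 0" "0 < h z" for w z
  proof -
    define p where "p = (h z / (h z + - h w)) *\<^sub>R w + (- h w / (h z + - h w)) *\<^sub>R z"
    have D: "convex D"
      using f by (simp add: convex_on_def)
    have p: "p \<in> D"
      unfolding p_def using wz D by (intro convex_weighted_mem) auto
    have "(h z + - h w) * h p \<le> h z * h w + - h w * h z"
      unfolding p_def using wz h by (intro convex_on_weighted) auto
    moreover have "(h z + - h w) * (- h p) \<le> h z * (- h w) + - h w * (- h z)"
      unfolding p_def using wz h
      by (intro convex_on_weighted[of D "\<lambda>x. - h x"]) (auto simp: concave_on_def)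
    ultimately have "(h z + - h w) * h p = 0"
      by (simp add: mult.commute[of "h w" "h z"])
    then have "h p = 0"
      using wz by simp
    then have "0 \<le> (h z + - h w) * f p"
      using wz nonneg[OF p] by simp
    also have "\<dots> \<le> h z * f w + - h w * f z"
      unfolding p_def using wz f by (intro convex_on_weighted) auto
    finally show ?thesis .
  qed
  show ?thesis
  proof (rule multiplier_of_cross_inequality[of w0 D h f "- f z0 / h z0"])
    fix w assume w: "w \<in> D" "h w < 0"
    have "(- f z0) * (- h w) \<le> f w * h z0"
      using cross[OF w(1) wz0(2) w(2) wz0(4)] by (simp add: algebra_simps)
    then show "- f z0 / h z0 \<le> f w / - h w"
      using w wz0 by (simp add: field_simps)
  qed (use wz0 cross nonneg in \<open>auto intro: that\<close>)
qed

section \<open>The multiplier rule for finitely many constraints\<close>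

lemma inequality_multipliers:
  fixes f :: "'a::real_vector \<Rightarrow> real" and g :: "'i \<Rightarrow> 'a \<Rightarrow> real"
  assumes "finite I" and "convex_on D f" and "\<And>i. i \<in> I \<Longrightarrow> convex_on D (g i)"
    and "z0 \<in> D" and "\<And>i. i \<in> I \<Longrightarrow> g i z0 < 0"
    and "\<And>z. z \<in> D \<Longrightarrow> (\<And>i. i \<in> I \<Longrightarrow> g i z \<le> 0) \<Longrightarrow> 0 \<le> f z"
  shows "\<exists>l. (\<forall>i\<in>I. 0 \<le> l i) \<and> (\<forall>z\<in>D. 0 \<le> f z + (\<Sum>i\<in>I. l i * g i z))"
  using assms
proof (induction I arbitrary: f rule: finite_induct)
  case empty
  then show ?case
    by simp
next
  case (insert i I)
  \<comment> \<open>The multiplier of \<open>g i\<close> is found on the part of \<open>D\<close> cut out by the other constraints,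
    so that \<open>f + c * g i\<close> is an admissible objective for those.\<close>
  define E where "E = {z \<in> D. \<forall>i\<in>I. g i z \<le> 0}"
  have D: "convex D"
    using insert.prems(1) by (simp add: convex_on_def)
  have "E = D \<inter> (\<Inter>i\<in>I. {z \<in> D. g i z \<le> 0})"
    by (auto simp: E_def)
  moreover have "convex {z \<in> D. g i z \<le> 0}" if "i \<in> I" for i
    using that insert.prems(2) by (intro convex_sublevel) auto
  ultimately have E: "convex E"
    using D by (auto intro!: convex_Int convex_INT)
  have ED: "E \<subseteq> D"
    by (auto simp: E_def)
  obtain c where c: "0 \<le> c" "\<And>z. z \<in> E \<Longrightarrow> 0 \<le> f z + c * g i z"
  proof (rule inequality_multiplier[of E f "g i" z0])
    show "convex_on E f" "convex_on E (g i)"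
      using insert.prems(1,2) ED E by (auto intro: convex_on_subset)
    show "z0 \<in> E" "g i z0 < 0"
      using insert.prems(3,4) by (auto simp: E_def intro: less_imp_le)
    show "0 \<le> f z" if "z \<in> E" "g i z \<le> 0" for z
      using that insert.prems(5)[of z] by (auto simp: E_def)
  qed blast
  have "\<exists>l. (\<forall>i\<in>I. 0 \<le> l i) \<and> (\<forall>z\<in>D. 0 \<le> (f z + c * g i z) + (\<Sum>i\<in>I. l i * g i z))"
  proof (rule insert.IH)
    show "convex_on D (\<lambda>z. f z + c * g i z)"
      using insert.prems(1,2) c(1) by (intro convex_on_add convex_on_cmul) auto
    show "0 \<le> f z + c * g i z" if "z \<in> D" "\<And>i. i \<in> I \<Longrightarrow> g i z \<le> 0" for z
      using that c(2) by (simp add: E_def)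
  qed (use insert.prems in auto)
  then obtain l where l: "\<forall>i\<in>I. 0 \<le> l i"
      "\<forall>z\<in>D. 0 \<le> (f z + c * g i z) + (\<Sum>i\<in>I. l i * g i z)"
    by blast
  have sum: "(\<Sum>j\<in>I. (l(i := c)) j * g j z) = (\<Sum>j\<in>I. l j * g j z)" for z
    using insert.hyps(2) by (intro sum.cong) auto
  show ?case
    using l c(1) insert.hyps sum by (intro exI[of _ "l(i := c)"]) (auto simp: add.assoc)
qed

text \<open>The hypothesis \<open>prolong\<close> says that \<open>z0\<close> lies in the algebraic interior of \<open>D\<close> relative to
  its affine hull. Prolonging a segment from \<open>w\<close> through \<open>z0\<close> multiplies the values of all the
  affine functions by one and the same negative number, since they vanish at \<open>z0\<close>. Hence the
  far end stays in the slice \<open>E\<close> of the constraints still present, while the function being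
  removed changes sign along it unless it vanishes at \<open>w\<close>.\<close>

lemma equality_multipliers:
  fixes f :: "'a::real_vector \<Rightarrow> real" and h :: "'j \<Rightarrow> 'a \<Rightarrow> real"
  assumes "finite J" and "convex_on D f"
    and "\<And>j. j \<in> J \<Longrightarrow> convex_on D (h j)" and "\<And>j. j \<in> J \<Longrightarrow> concave_on D (h j)"
    and "\<And>j. j \<in> J \<Longrightarrow> h j z0 = 0"
    and prolong: "\<And>w. w \<in> D \<Longrightarrow> \<exists>v\<in>D. \<exists>a>0. \<exists>b>0. z0 = (a / (a + b)) *\<^sub>R w + (b / (a + b)) *\<^sub>R v"
    and "\<And>z. z \<in> D \<Longrightarrow> (\<And>j. j \<in> J \<Longrightarrow> h j z = 0) \<Longrightarrow> 0 \<le> f z"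
  shows "\<exists>\<nu>. \<forall>z\<in>D. 0 \<le> f z + (\<Sum>j\<in>J. \<nu> j * h j z)"
  using assms(1-5,7)
proof (induction J arbitrary: f rule: finite_induct)
  case empty
  then show ?case
    by simp
next
  case (insert j J)
  define E where "E = {z \<in> D. \<forall>j\<in>J. h j z = 0}"
  have E: "convex E"
    unfolding E_def using insert.prems(1-3)
    by (intro convex_affine_slice) (auto simp: convex_on_def)
  have ED: "E \<subseteq> D"
    by (auto simp: E_def)
  have opposite: "\<exists>v\<in>D. \<exists>a>0. \<exists>b>0. \<forall>i\<in>insert j J. a * h i w + b * h i v = 0"
    if w: "w \<in> D" for w
  proof -
    obtain v a b where v: "v \<in> D" "0 < a" "0 < b" "z0 = (a / (a + b)) *\<^sub>R w + (b / (a + b)) *\<^sub>R v"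
      using prolong[OF w] by blast
    have "a * h i w + b * h i v = 0" if i: "i \<in> insert j J" for i
    proof -
      have "(a + b) * h i z0 \<le> a * h i w + b * h i v"
        unfolding v(4) using v w i insert.prems(2) by (intro convex_on_weighted) auto
      moreover have "(a + b) * (- h i z0) \<le> a * (- h i w) + b * (- h i v)"
        unfolding v(4) using v w i insert.prems(3)
        by (intro convex_on_weighted[of D "\<lambda>x. - h i x"]) (auto simp: concave_on_def)
      ultimately show ?thesis
        using insert.prems(4)[OF i] by simp
    qed
    then show ?thesis
      using v by blast
  qed
  have signs: "\<exists>w\<in>E. \<exists>z\<in>E. h j w < 0 \<and> 0 < h j z" if w: "w \<in> E" "h j w \<noteq> 0" for w
  proof -
    obtain v a b where v: "v \<in> D" "0 < a" "0 < b"
        "\<forall>i\<in>insert j J. a * h i w + b * h i v = 0"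
      using opposite[of w] w ED by blast
    have "b * h i v = 0" if "i \<in> J" for i
      using v(4) w(1) that by (auto simp: E_def)
    then have vE: "v \<in> E"
      using v(1,3) by (simp add: E_def)
    have eq: "a * h j w = - (b * h j v)"
      using v(4) by (simp add: eq_neg_iff_add_eq_0)
    show ?thesis
    proof (cases "h j w < 0")
      case True
      then have "a * h j w < 0"
        using v(2) by (simp add: mult_less_0_iff)
      then have "0 < h j v"
        using eq v(3) by (simp add: zero_less_mult_iff)
      then show ?thesis
        using True w vE by blast
    next
      case False
      then have "0 < a * h j w"
        using v(2) w(2) by simp
      then have "h j v < 0"
        using eq v(3) by (simp add: mult_less_0_iff)
      then show ?thesis
        using False w vE by (metis linorder_neqE_linordered_idom)
    qed
  qed
  obtain c where c: "\<And>z. z \<in> E \<Longrightarrow> 0 \<le> f z + c * h j z"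
  proof (rule equality_multiplier[of E f "h j"])
    show "convex_on E f" "convex_on E (h j)" "concave_on E (h j)"
      using insert.prems(1-3) ED E by (auto simp: concave_on_def intro: convex_on_subset)
    show "0 \<le> f z" if "z \<in> E" "h j z = 0" for z
      using that insert.prems(5)[of z] by (auto simp: E_def)
  qed (use signs in blast)+
  have ch: "convex_on D (\<lambda>z. c * h j z)"
  proof (cases "0 \<le> c")
    case True
    then show ?thesis
      using insert.prems(2) by (intro convex_on_cmul) auto
  next
    case False
    then have "convex_on D (\<lambda>z. (- c) * (- h j z))"
      using insert.prems(3) by (intro convex_on_cmul) (auto simp: concave_on_def)
    then show ?thesis
      by simp
  qed
  have "\<exists>\<nu>. \<forall>z\<in>D. 0 \<le> (f z + c * h j z) + (\<Sum>i\<in>J. \<nu> i * h i z)"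
  proof (rule insert.IH)
    show "convex_on D (\<lambda>z. f z + c * h j z)"
      using insert.prems(1) ch by (rule convex_on_add)
    show "0 \<le> f z + c * h j z" if "z \<in> D" "\<And>i. i \<in> J \<Longrightarrow> h i z = 0" for z
      using that c by (simp add: E_def)
  qed (use insert.prems in auto)
  then obtain \<nu> where \<nu>: "\<forall>z\<in>D. 0 \<le> (f z + c * h j z) + (\<Sum>i\<in>J. \<nu> i * h i z)"
    by blast
  have sum: "(\<Sum>i\<in>J. (\<nu>(j := c)) i * h i z) = (\<Sum>i\<in>J. \<nu> i * h i z)" for z
    using insert.hyps(2) by (intro sum.cong) auto
  show ?case
    using \<nu> insert.hyps sum by (intro exI[of _ "\<nu>(j := c)"]) (auto simp: add.assoc)
qed

text \<open>The inequalities are removed first, on the affine slice \<open>S\<close> of \<open>D\<close>, which contains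
  the Slater point. The equalities are then removed on \<open>D\<close> itself. In the opposite order
  they would have to be removed on the part of \<open>D\<close> where \<open>g i \<le> 0\<close>, where the prolongation
  property would first have to be established.\<close>

theorem convex_multiplier_rule:
  fixes f :: "'a::real_vector \<Rightarrow> real"
    and g :: "'i \<Rightarrow> 'a \<Rightarrow> real" and h :: "'j \<Rightarrow> 'a \<Rightarrow> real"
  assumes fin: "finite I" "finite J"
    and f: "convex_on D f"
    and g: "\<And>i. i \<in> I \<Longrightarrow> convex_on D (g i)"
    and h: "\<And>j. j \<in> J \<Longrightarrow> convex_on D (h j)" "\<And>j. j \<in> J \<Longrightarrow> concave_on D (h j)"
    and z0: "z0 \<in> D" "\<And>i. i \<in> I \<Longrightarrow> g i z0 < 0" "\<And>j. j \<in> J \<Longrightarrow> h j z0 = 0"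
    and prolong: "\<And>w. w \<in> D \<Longrightarrow> \<exists>v\<in>D. \<exists>a>0. \<exists>b>0. z0 = (a / (a + b)) *\<^sub>R w + (b / (a + b)) *\<^sub>R v"
    and nonneg: "\<And>z. z \<in> D \<Longrightarrow> (\<And>i. i \<in> I \<Longrightarrow> g i z \<le> 0) \<Longrightarrow> (\<And>j. j \<in> J \<Longrightarrow> h j z = 0) \<Longrightarrow> 0 \<le> f z"
  obtains l \<nu> where "\<And>i. i \<in> I \<Longrightarrow> 0 \<le> l i"
    "\<And>z. z \<in> D \<Longrightarrow> 0 \<le> f z + (\<Sum>i\<in>I. l i * g i z) + (\<Sum>j\<in>J. \<nu> j * h j z)"
proof -
  define S where "S = {z \<in> D. \<forall>j\<in>J. h j z = 0}"
  have D: "convex D"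
    using f by (simp add: convex_on_def)
  have S: "convex S"
    unfolding S_def using D h by (intro convex_affine_slice)
  have SD: "S \<subseteq> D"
    by (auto simp: S_def)
  have "\<exists>l. (\<forall>i\<in>I. 0 \<le> l i) \<and> (\<forall>z\<in>S. 0 \<le> f z + (\<Sum>i\<in>I. l i * g i z))"
  proof (rule inequality_multipliers[of I S f g z0])
    show "convex_on S f" "\<And>i. i \<in> I \<Longrightarrow> convex_on S (g i)"
      using f g SD S by (auto intro: convex_on_subset)
    show "0 \<le> f z" if "z \<in> S" "\<And>i. i \<in> I \<Longrightarrow> g i z \<le> 0" for z
      using that nonneg[of z] by (auto simp: S_def)
  qed (use fin z0 in \<open>auto simp: S_def\<close>)
  then obtain l where l: "\<forall>i\<in>I. 0 \<le> l i" "\<forall>z\<in>S. 0 \<le> f z + (\<Sum>i\<in>I. l i * g i z)"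
    by blast
  have "\<exists>\<nu>. \<forall>z\<in>D. 0 \<le> (f z + (\<Sum>i\<in>I. l i * g i z)) + (\<Sum>j\<in>J. \<nu> j * h j z)"
  proof (rule equality_multipliers[of J D _ h z0])
    have "convex_on D (\<lambda>z. \<Sum>i\<in>I. l i * g i z)"
      using fin(1) g l(1)
    proof (induction I rule: finite_induct)
      case empty
      then show ?case
        using D by (simp add: convex_on_def)
    next
      case (insert i I)
      then show ?case
        by (auto intro!: convex_on_add convex_on_cmul)
    qed
    then show "convex_on D (\<lambda>z. f z + (\<Sum>i\<in>I. l i * g i z))"
      using f by (intro convex_on_add)
    show "0 \<le> f z + (\<Sum>i\<in>I. l i * g i z)" if "z \<in> D" "\<And>j. j \<in> J \<Longrightarrow> h j z = 0" for z
      using that l(2) by (simp add: S_def)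
  qed (use fin h z0 prolong in auto)
  then show ?thesis
    using l that by blast
qed

section \<open>Extended-real convex functions and prolongation of segments\<close>

lemma ereal_convex_ineq:
  assumes "ereal_convex \<phi>" "\<And>z. \<phi> z > -\<infinity>" "\<phi> x < \<infinity>" "\<phi> y < \<infinity>"
    and "0 \<le> u" "0 \<le> v" "u + v = 1"
  shows "\<phi> (u *\<^sub>R x + v *\<^sub>R y) \<le> ereal (u * real_of_ereal (\<phi> x) + v * real_of_ereal (\<phi> y))"
proof -
  have "ereal (real_of_ereal (\<phi> z)) = \<phi> z" if "\<phi> z < \<infinity>" for z
    using that assms(2)[of z] by (intro ereal_real') auto
  then have "(x, real_of_ereal (\<phi> x)) \<in> ereal_epigraph \<phi>" "(y, real_of_ereal (\<phi> y)) \<in> ereal_epigraph \<phi>"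
    using assms(3,4) by (auto simp: ereal_epigraph_def)
  then have "u *\<^sub>R (x, real_of_ereal (\<phi> x)) + v *\<^sub>R (y, real_of_ereal (\<phi> y)) \<in> ereal_epigraph \<phi>"
    using assms(1,5-7) unfolding ereal_convex_def by (intro convexD)
  then show ?thesis
    by (simp add: ereal_epigraph_def)
qed

lemma convex_on_real_of_ereal:
  assumes \<phi>: "ereal_convex \<phi>" "\<And>z. \<phi> z > -\<infinity>" and C: "convex C"
  shows "convex_on {z \<in> C. \<phi> z < \<infinity>} (\<lambda>z. real_of_ereal (\<phi> z))"
proof -
  have *: "\<phi> (u *\<^sub>R x + v *\<^sub>R y) \<le> ereal (u * real_of_ereal (\<phi> x) + v * real_of_ereal (\<phi> y))"
    if "\<phi> x < \<infinity>" "\<phi> y < \<infinity>" "0 \<le> u" "0 \<le> v" "u + v = 1" for x y u v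
    using ereal_convex_ineq[OF \<phi> that] .
  have le: "real_of_ereal t \<le> r" if "t \<le> ereal r" "t > -\<infinity>" for t r
    using that by (cases t) auto
  show ?thesis
    unfolding convex_on_def
  proof (intro conjI allI ballI impI)
    show "convex {z \<in> C. \<phi> z < \<infinity>}"
    proof (rule convexI)
      fix x y and u v :: real
      assume "x \<in> {z \<in> C. \<phi> z < \<infinity>}" "y \<in> {z \<in> C. \<phi> z < \<infinity>}" "0 \<le> u" "0 \<le> v" "u + v = 1"
      then show "u *\<^sub>R x + v *\<^sub>R y \<in> {z \<in> C. \<phi> z < \<infinity>}"
        using *[of x y u v] C by (auto intro: convexD le_less_trans)
    qed
  qed (use * le \<phi>(2) in auto)
qed

text \<open>The prolonged end point is \<open>v = z0 + t (z0 - z)\<close> for a small \<open>t > 0\<close>, which tends to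
  \<open>z0\<close> by continuity of scalar multiplication in each factor; then
  \<open>z0 = (t z + v) / (t + 1)\<close>.\<close>

lemma prolong_segment:
  fixes x0 x :: "'x::locally_convex_space" and y0 y :: "'y::locally_convex_space"
  assumes "eventually P (nhds (x0, y0))"
  shows "\<exists>v. P v \<and> (\<exists>a>0. \<exists>b>0. (x0, y0) = (a / (a + b)) *\<^sub>R (x, y) + (b / (a + b)) *\<^sub>R v)"
proof -
  have lim: "((\<lambda>t. z + t *\<^sub>R w) \<longlongrightarrow> z) (at_right 0)" for z w :: "'b::locally_convex_space"
  proof -
    have "((\<lambda>t. (t, w)) \<longlongrightarrow> (0, w)) (at_right (0::real))"
      by (intro tendsto_intros)
    then have "filterlim (\<lambda>t. (t, w)) (nhds 0 \<times>\<^sub>F nhds w) (at_right (0::real))"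
      by (simp add: nhds_prod)
    from filterlim_compose[OF tendsto_scaleR_Pair this]
    have "((\<lambda>t. t *\<^sub>R w) \<longlongrightarrow> 0 *\<^sub>R w) (at_right 0)"
      by simp
    from tendsto_add[OF tendsto_const[of z] this] show ?thesis
      by simp
  qed
  define p where "p t = (x0 + t *\<^sub>R (x0 - x), y0 + t *\<^sub>R (y0 - y))" for t :: real
  have "(p \<longlongrightarrow> (x0, y0)) (at_right 0)"
    unfolding p_def by (intro tendsto_Pair lim)
  then have "eventually (\<lambda>t. P (p t)) (at_right 0)"
    using assms by (simp add: filterlim_iff)
  then have "eventually (\<lambda>t. P (p t) \<and> 0 < t) (at_right 0)"
    by (intro eventually_conj) (simp_all add: eventually_at_right_less)
  then obtain t where t: "P (p t)" "0 < t"
    using eventually_happens'[OF trivial_limit_at_right_real] by blast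
  have *: "z0 = (t / (t + 1)) *\<^sub>R z + (1 / (t + 1)) *\<^sub>R (z0 + t *\<^sub>R (z0 - z))"
    for z0 z :: "'b::real_vector"
  proof -
    have "(t / (t + 1)) *\<^sub>R z + (1 / (t + 1)) *\<^sub>R (z0 + t *\<^sub>R (z0 - z)) = (1 / (t + 1) + t / (t + 1)) *\<^sub>R z0"
      by (simp add: algebra_simps)
    also have "1 / (t + 1) + t / (t + 1) = 1"
      using t(2) by (simp flip: add_divide_distrib)
    finally show ?thesis
      by simp
  qed
  have "(x0, y0) = (t / (t + 1)) *\<^sub>R (x, y) + (1 / (t + 1)) *\<^sub>R p t"
    using *[of x0 x] *[of y0 y] by (simp add: p_def)
  then show ?thesis
    using t by (intro exI[of _ "p t"] conjI exI[of _ t] exI[of _ 1]) auto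
qed

lemma eventually_mem_interior_dom:
  assumes "continuous_at_point \<phi> z0" "z0 \<in> interior C"
  shows "eventually (\<lambda>z. z \<in> C \<and> \<phi> z < \<infinity>) (nhds z0)"
proof (rule eventually_conj)
  show "eventually (\<lambda>z. z \<in> C) (nhds z0)"
    using assms(2) interior_subset[of C] eventually_nhds open_interior by blast
  have "(\<phi> \<longlongrightarrow> \<phi> z0) (nhds z0)"
    using assms(1) by (simp add: continuous_at_point_def continuous_at tendsto_at_iff_tendsto_nhds)
  then show "eventually (\<lambda>z. \<phi> z < \<infinity>) (nhds z0)"
    using assms(1) by (intro order_tendstoD) (auto simp: continuous_at_point_def)
qed

section \<open>Subgradients of the optimal value function\<close>

theorem theorem9:
  fixes \<phi> :: "'x::locally_convex_space \<times> 'y::locally_convex_space \<Rightarrow> ereal"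
    and C :: "('x \<times> 'y) set"
    and m k :: nat
    and g h :: "nat \<Rightarrow> 'x \<times> 'y \<Rightarrow> real"
    and xs :: "nat \<Rightarrow> 'x \<Rightarrow> real" and ys :: "nat \<Rightarrow> 'y \<Rightarrow> real" and \<alpha> :: "nat \<Rightarrow> real"
    and xb x0 :: 'x and yb y0 :: 'y
  assumes "proper \<phi>" and "ereal_convex \<phi>"
    and "\<And>i. i \<in> {1..m} \<Longrightarrow> continuous_on UNIV (g i)"
    and "\<And>i. i \<in> {1..m} \<Longrightarrow> convex_on UNIV (g i)"
    and "convex C"
    and "\<And>j. j \<in> {1..k} \<Longrightarrow> xs j \<in> dual_space"
    and "\<And>j. j \<in> {1..k} \<Longrightarrow> ys j \<in> dual_space"
    and "\<And>j x y. j \<in> {1..k} \<Longrightarrow> h j (x, y) = xs j x + ys j y - \<alpha> j"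
    and "xb \<in> effective_domain (optimal_value m k \<phi> C g h)"
    and "solution_map m k \<phi> C g h xb \<noteq> {}"
    and "continuous_at_point \<phi> (x0, y0)"
    and "(x0, y0) \<in> interior C"
    and "\<And>i. i \<in> {1..m} \<Longrightarrow> g i (x0, y0) < 0"
    and "\<And>j. j \<in> {1..k} \<Longrightarrow> h j (x0, y0) = 0"
    and "yb \<in> solution_map m k \<phi> C g h xb"
  shows "subdifferential (optimal_value m k \<phi> C g h) xb
    \<subseteq> (\<Union>(l, \<nu>)\<in>Lagrange_multipliers m k \<phi> C g h xb yb.
          subdifferential (\<lambda>x. Lagrangian m k \<phi> C g h x yb l \<nu>) xb)"
proof
  fix xt assume xt: "xt \<in> subdifferential (optimal_value m k \<phi> C g h) xb"
  let ?\<mu> = "optimal_value m k \<phi> C g h"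
  define D where "D = {z \<in> C. \<phi> z < \<infinity>}"
  define r where "r z = real_of_ereal (\<phi> z)" for z
  define f where "f z = r z - r (xb, yb) - xt (fst z - xb)" for z :: "'x \<times> 'y"
  have \<phi>_gt: "\<phi> z > -\<infinity>" for z
    using assms(1) unfolding proper_def by blast
  have \<phi>_eq: "\<phi> z = ereal (r z)" if "\<phi> z < \<infinity>" for z
    using that \<phi>_gt[of z] unfolding r_def by (intro ereal_real'[symmetric]) auto
  have dual: "xt \<in> dual_space" and lin: "linear xt"
    and fin: "\<bar>?\<mu> xb\<bar> \<noteq> \<infinity>" and sub: "\<And>x. ereal (xt (x - xb)) \<le> ?\<mu> x - ?\<mu> xb"
    using xt by (auto simp: subdifferential_def dual_space_def)
  have yb: "(xb, yb) \<in> C" "\<And>i. i \<in> {1..m} \<Longrightarrow> g i (xb, yb) \<le> 0"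
      "\<And>j. j \<in> {1..k} \<Longrightarrow> h j (xb, yb) = 0" and \<mu>xb: "?\<mu> xb = \<phi> (xb, yb)"
    using assms(15) by (auto simp: solution_map_def feasible_def)
  have \<phi>b: "\<phi> (xb, yb) = ereal (r (xb, yb))"
    using fin \<mu>xb by (intro \<phi>_eq) auto
  then have bD: "(xb, yb) \<in> D"
    using yb by (simp add: D_def)
  have near: "eventually (\<lambda>z. z \<in> D) (nhds (x0, y0))"
    using eventually_mem_interior_dom[OF assms(11,12)] by (simp add: D_def)
  have "convex_on D r"
    using convex_on_real_of_ereal[OF assms(2) \<phi>_gt assms(5)] unfolding D_def r_def .
  then have D: "convex D" and r: "convex_on D r"
    by (auto simp: convex_on_def)
  have affine: "convex_on D (\<lambda>z. p (fst z) + q (snd z) + d)"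
    if "linear p" "linear q" for p q and d :: real
  proof (rule convex_onI)
    fix t and z w :: "'x \<times> 'y" assume "0 < t" "t < (1::real)"
    show "p (fst ((1 - t) *\<^sub>R z + t *\<^sub>R w)) + q (snd ((1 - t) *\<^sub>R z + t *\<^sub>R w)) + d
      \<le> (1 - t) * (p (fst z) + q (snd z) + d) + t * (p (fst w) + q (snd w) + d)"
      by (simp add: linear_add[OF that(1)] linear_add[OF that(2)] linear_scale[OF that(1)]
          linear_scale[OF that(2)] distrib_left) (simp add: algebra_simps)
  qed (rule D)
  have f: "convex_on D f"
  proof -
    have "convex_on D (\<lambda>z. r z + (- xt (fst z) + 0 + (xt xb - r (xb, yb))))"
      using r by (intro convex_on_add affine[of "\<lambda>x. - xt x" "\<lambda>_. 0"])
        (auto intro: linear_compose_neg lin linear_zero)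
    moreover have "f = (\<lambda>z. r z + (- xt (fst z) + 0 + (xt xb - r (xb, yb))))"
      by (auto simp: f_def linear_diff[OF lin])
    ultimately show ?thesis
      by simp
  qed
  have h: "convex_on D (h j)" "concave_on D (h j)" if j: "j \<in> {1..k}" for j
  proof -
    have l: "linear (xs j)" "linear (ys j)"
      using assms(6,7)[OF j] by (auto simp: dual_space_def)
    have "h j = (\<lambda>z. xs j (fst z) + ys j (snd z) + - \<alpha> j)"
      using assms(8)[OF j] by (auto simp: fun_eq_iff)
    then show "convex_on D (h j)"
      using affine[OF l, of "- \<alpha> j"] by simp
    have "(\<lambda>z. - h j z) = (\<lambda>z. - xs j (fst z) + - ys j (snd z) + \<alpha> j)"
      using assms(8)[OF j] by (auto simp: fun_eq_iff)
    then show "concave_on D (h j)"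
      using affine[of "\<lambda>x. - xs j x" "\<lambda>y. - ys j y" "\<alpha> j"] l
      by (simp add: concave_on_def linear_compose_neg)
  qed
  have nonneg: "0 \<le> f z"
    if z: "z \<in> D" "\<And>i. i \<in> {1..m} \<Longrightarrow> g i z \<le> 0" "\<And>j. j \<in> {1..k} \<Longrightarrow> h j z = 0" for z
  proof -
    obtain x y where xy: "z = (x, y)"
      by (cases z)
    have \<phi>z: "\<phi> z = ereal (r z)"
      using z by (intro \<phi>_eq) (simp add: D_def)
    have "?\<mu> x \<le> \<phi> z"
      unfolding optimal_value_def xy using z xy
      by (intro INF_lower) (auto simp: feasible_def D_def)
    then have "?\<mu> x - ?\<mu> xb \<le> \<phi> z - ?\<mu> xb"
      by (intro ereal_minus_mono) auto
    with sub[of x] have "ereal (xt (x - xb)) \<le> \<phi> z - ?\<mu> xb"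
      by (rule order_trans)
    then show ?thesis
      by (simp add: \<phi>z[unfolded xy] \<mu>xb \<phi>b f_def xy)
  qed
  obtain l' \<nu>' where l': "\<And>i. i \<in> {1..m} \<Longrightarrow> 0 \<le> l' i"
    and bound': "\<And>z. z \<in> D \<Longrightarrow> 0 \<le> f z + (\<Sum>i\<in>{1..m}. l' i * g i z) + (\<Sum>j\<in>{1..k}. \<nu>' j * h j z)"
  proof (rule convex_multiplier_rule[of "{1..m}" "{1..k}" D f g h "(x0, y0)"])
    show "(x0, y0) \<in> D"
      using eventually_nhds_x_imp_x[OF near] .
    show "convex_on D (g i)" if "i \<in> {1..m}" for i
      using assms(4)[OF that] D by (auto intro: convex_on_subset)
    show "\<exists>v\<in>D. \<exists>a>0. \<exists>b>0. (x0, y0) = (a / (a + b)) *\<^sub>R w + (b / (a + b)) *\<^sub>R v" for w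
      using prolong_segment[OF near, of "fst w" "snd w"] unfolding prod.collapse by blast
  qed (use f h nonneg assms(13,14) in auto)
  define l where "l = restrict l' {1..m}"
  define \<nu> where "\<nu> = restrict \<nu>' {1..k}"
  have l: "0 \<le> l i" if "i \<in> {1..m}" for i
    using l' that by (simp add: l_def)
  have bound: "0 \<le> f z + (\<Sum>i\<in>{1..m}. l i * g i z) + (\<Sum>j\<in>{1..k}. \<nu> j * h j z)" if "z \<in> D" for z
    using bound'[OF that] by (simp add: l_def \<nu>_def)
  \<comment> \<open>At the optimal pair every summand \<open>l i * g i\<close> is nonpositive, while the bound makes
    their sum nonnegative.\<close>
  have hb: "(\<Sum>j\<in>{1..k}. \<nu> j * h j (xb, yb)) = 0"
    using yb(3) by simp
  have slack_le: "l i * g i (xb, yb) \<le> 0" if "i \<in> {1..m}" for i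
    using l[OF that] yb(2)[OF that] by (simp add: mult_nonneg_nonpos)
  have "0 \<le> (\<Sum>i\<in>{1..m}. l i * g i (xb, yb))"
    using bound[OF bD] hb by (simp add: f_def linear_0[OF lin])
  then have gb: "(\<Sum>i\<in>{1..m}. l i * g i (xb, yb)) = 0"
    using sum_nonpos[of "{1..m}" "\<lambda>i. l i * g i (xb, yb)"] slack_le by (intro antisym) auto
  have slack: "l i * g i (xb, yb) = 0" if "i \<in> {1..m}" for i
  proof -
    have "(\<Sum>i\<in>{1..m}. - (l i * g i (xb, yb))) = 0"
      using gb by (simp add: sum_negf)
    then show ?thesis
      using that slack_le
        sum_nonneg_eq_0_iff[of "{1..m}" "\<lambda>i. - (l i * g i (xb, yb))"] by simp
  qed
  have Lb: "Lagrangian m k \<phi> C g h xb yb l \<nu> = ereal (r (xb, yb))"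
    using hb gb \<phi>b yb(1) by (simp add: Lagrangian_def indicator_fun_def flip: zero_ereal_def)
  have L: "ereal (xt (x - xb)) \<le> Lagrangian m k \<phi> C g h x y l \<nu> - ereal (r (xb, yb))" for x y
  proof (cases "(x, y) \<in> D")
    case True
    then have "\<phi> (x, y) = ereal (r (x, y))" "(x, y) \<in> C"
      by (auto simp: D_def intro: \<phi>_eq)
    then show ?thesis
      using bound[OF True] by (simp add: Lagrangian_def indicator_fun_def f_def)
  next
    case False
    have "Lagrangian m k \<phi> C g h x y l \<nu> = \<infinity>"
      using False \<phi>_gt[of "(x, y)"]
      by (cases "\<phi> (x, y)") (auto simp: Lagrangian_def indicator_fun_def D_def)
    then show ?thesis
      by simp
  qed
  have zero: "(\<lambda>_. 0) \<in> dual_space"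
    by (simp add: dual_space_def linear_zero)
  have "(\<lambda>_. 0) \<in> subdifferential (\<lambda>y. Lagrangian m k \<phi> C g h xb y l \<nu>) yb"
    using L[of xb] zero by (simp add: subdifferential_def Lb linear_0[OF lin])
  then have "(l, \<nu>) \<in> Lagrange_multipliers m k \<phi> C g h xb yb"
    using l slack by (auto simp: Lagrange_multipliers_def l_def \<nu>_def)
  moreover have "xt \<in> subdifferential (\<lambda>x. Lagrangian m k \<phi> C g h x yb l \<nu>) xb"
    using L[of _ yb] dual by (simp add: subdifferential_def Lb)
  ultimately show "xt \<in> (\<Union>(l, \<nu>)\<in>Lagrange_multipliers m k \<phi> C g h xb yb.
          subdifferential (\<lambda>x. Lagrangian m k \<phi> C g h x yb l \<nu>) xb)"
    by blast
qed

end
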